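(* The family $\{\mathbb{P}_N^\theta,\theta\in\mathbb{R}_+\}$ is uniformly asymptotically normal (as $N\to\infty$).
   Context: $\mathbb{R}_+:=(0,\infty)$. $(\Omega,\mathscr{F},\{\mathscr{F}_t\},\mathbb{P})$ is a stochastic basis satisfying the usual assumptions, with independent standard Brownian motions $\{w_k\}_{k\in\mathbb{N}}$. $\{\mu_k\}\subset(0,\infty)$ with $\mu_k\to\infty$ (the eigenvalues of a positive definite self-adjoint operator $A$ on a separable Hilbert space), $\{q_k\}\subset(0,\infty)$, $\sigma>0$ and $T>0$ are fixed and known. For $\theta\in\mathbb{R}_+$, $u_k^\theta$ is the $k$-th Fourier mode of the solution of $du+\theta Au\,dt=\sigma\sum_ku_kh_kq_k\,dw_k$ ($h_k$ the eigenvectors of $A$), i.e. $du_k^\theta=-\theta\mu_ku_k^\theta\,dt+\sigma q_ku_k^\theta\,dw_k$, so $u_k^\theta(t)=u_k(0)\exp\big(-(\theta\mu_k+\tfrac12\sigma^2q_k^2)t+\sigma q_kw_k(t)\big)$, $t\in[0,T]$, with $\mathscr{F}_0$-measurable $u_k(0)\ne0$ not depending on $\theta$. $U_N^\theta:=\{(u_1^\theta(t),\dots,u_N^\theta(t)),t\in[0,T]\}$ and $\mathbb{P}_N^\theta$ is its law on $C([0,T];\mathbb{R}^N)$. For $\theta,\vartheta\in\mathbb{R}_+$ the laws are equivalent with $$\frac{d\mathbb{P}_N^\theta}{d\mathbb{P}_N^\vartheta}(U_N^\vartheta)=\exp\Big(\frac{\vartheta-\theta}{\sigma^2}\sum_{k=1}^N\mu_kq_k^{-2}\int_0^T\frac{du_k^\vartheta(t)}{u_k^\vartheta(t)}+\frac{(\vartheta^2-\theta^2)T}{2\sigma^2}\sum_{k=1}^N\mu_k^2q_k^{-2}\Big).$$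 Definition (Ibragimov--Khasminskii). The family is uniformly asymptotically normal if there are nonzero normalizing factors $\varphi(N,\theta)$, $N\in\mathbb{N}$, $\theta\in\mathbb{R}_+$, such that for all sequences $\{\vartheta_N\}\subset\mathbb{R}_+$ and $\{\eta_N\}\subset\mathbb{R}$ with $\eta_N\to\eta\in\mathbb{R}$ and $\theta_N:=\vartheta_N+\varphi(N,\vartheta_N)\eta_N\in\mathbb{R}_+$ for all $N$, one has the representation $$\frac{d\mathbb{P}_N^{\theta_N}}{d\mathbb{P}_N^{\vartheta_N}}(U_N^{\vartheta_N})=\exp\Big(\eta\,\Delta_{N,\vartheta_N}-\frac{\eta^2}{2}+\Psi_N(\eta_N,\vartheta_N)\Big),$$ where the random variables $\Delta_{N,\vartheta_N}$ (functions of $U_N^{\vartheta_N}$, not depending on $\eta_N$ or $\eta$) converge in distribution to $\mathcal{N}(0,1)$ and $\Psi_N(\eta_N,\vartheta_N)\to0$ in probability, as $N\to\infty$. *)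

theory Defs
  imports "HOL-Probability.Probability"
begin

locale stochastic_basis = prob_space M for M :: "'a measure" +
  fixes F :: "real \<Rightarrow> 'a measure"  \<comment> \<open>only \<open>F t\<close> with \<open>t \<ge> 0\<close> is relevant\<close>
  assumes complete: "\<And>A B. A \<in> null_sets M \<Longrightarrow> B \<subseteq> A \<Longrightarrow> B \<in> sets M"
    and subalgebra: "\<And>t. 0 \<le> t \<Longrightarrow> subalgebra M (F t)"
    and filtration_mono: "\<And>s t. 0 \<le> s \<Longrightarrow> s \<le> t \<Longrightarrow> sets (F s) \<subseteq> sets (F t)"
    and null_sets_initial: "null_sets M \<subseteq> sets (F 0)"
    and right_continuous: "\<And>s. 0 \<le> s \<Longrightarrow> sets (F s) = (\<Inter>t\<in>{s<..}. sets (F t))"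

text \<open>
  Independent standard Brownian motions \<open>w k\<close>, \<open>k \<ge> 1\<close>, relative to the filtration \<open>F\<close>. As usual
  for multidimensional Brownian motions on a filtered space, the last condition says that for
  \<open>s \<le> t\<close> the \<open>\<sigma>\<close>-algebra \<open>F s\<close> (index \<open>0\<close>) and the \<open>\<sigma>\<close>-algebras generated by the single increments
  \<open>w k t - w k s\<close> (indices \<open>k \<ge> 1\<close>) are jointly independent. Since the \<open>w k\<close> are adapted, this
  contains both the independence of each \<open>w k t - w k s\<close> from \<open>F s\<close> and the mutual independence of
  the processes \<open>w k\<close>; by Levy's characterisation it also follows from these two properties.
\<close>

definition (in stochastic_basis) independent_brownian_motions :: "(nat \<Rightarrow> real \<Rightarrow> 'a \<Rightarrow> real) \<Rightarrow> bool"
  where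
  "independent_brownian_motions w \<longleftrightarrow>
     (\<forall>k\<ge>1. \<forall>t\<ge>0. w k t \<in> borel_measurable (F t)) \<and>
     (\<forall>k\<ge>1. AE \<omega> in M. w k 0 \<omega> = 0) \<and>
     (\<forall>k\<ge>1. \<forall>\<omega>\<in>space M. continuous_on {0..} (\<lambda>t. w k t \<omega>)) \<and>
     (\<forall>k\<ge>1. \<forall>s t. 0 \<le> s \<longrightarrow> s < t \<longrightarrow>
        distributed M lborel (\<lambda>\<omega>. w k t \<omega> - w k s \<omega>) (normal_density 0 (sqrt (t - s)))) \<and>
     (\<forall>s t. 0 \<le> s \<longrightarrow> s \<le> t \<longrightarrow>
        indep_sets
          (\<lambda>k. if k = 0 then sets (F s)
               else {(\<lambda>\<omega>. w k t \<omega> - w k s \<omega>) -` B \<inter> space M | B. B \<in> sets borel})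
          UNIV)"

text \<open>
  The \<open>k\<close>-th Fourier mode, i.e. the explicit solution of
  \<open>du = - \<theta> \<mu>\<^sub>k u dt + \<sigma> q\<^sub>k u dw\<^sub>k\<close> with initial value \<open>u0 k\<close>.
\<close>

definition fourier_mode ::
  "(nat \<Rightarrow> real) \<Rightarrow> (nat \<Rightarrow> real) \<Rightarrow> real \<Rightarrow> (nat \<Rightarrow> 'a \<Rightarrow> real) \<Rightarrow> (nat \<Rightarrow> real \<Rightarrow> 'a \<Rightarrow> real) \<Rightarrow>
   real \<Rightarrow> nat \<Rightarrow> real \<Rightarrow> 'a \<Rightarrow> real" where
  "fourier_mode \<mu> q \<sigma> u0 w \<theta> k t \<omega> =
     u0 k \<omega> * exp (- (\<theta> * \<mu> k + \<sigma>\<^sup>2 * (q k)\<^sup>2 / 2) * t + \<sigma> * q k * w k t \<omega>)"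

text \<open>
  The measurable space \<open>C([0,T]; \<real>\<^sup>N)\<close>: continuous paths (extensional functions on \<open>{0..T}\<close> with
  extensional values on \<open>{1..N}\<close>) with the \<open>\<sigma>\<close>-algebra generated by the evaluation maps, which
  coincides with the Borel \<open>\<sigma>\<close>-algebra of the uniform topology.
\<close>

definition path_space :: "real \<Rightarrow> nat \<Rightarrow> (real \<Rightarrow> nat \<Rightarrow> real) measure" where
  "path_space T N =
     restrict_space (Pi\<^sub>M {0..T} (\<lambda>_. Pi\<^sub>M {1..N} (\<lambda>_. borel)))
       {x. \<forall>k\<in>{1..N}. continuous_on {0..T} (\<lambda>t. x t k)}"

definition observed_path ::
  "(nat \<Rightarrow> real) \<Rightarrow> (nat \<Rightarrow> real) \<Rightarrow> real \<Rightarrow> (nat \<Rightarrow> 'a \<Rightarrow> real) \<Rightarrow> (nat \<Rightarrow> real \<Rightarrow> 'a \<Rightarrow> real) \<Rightarrow>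
   real \<Rightarrow> nat \<Rightarrow> real \<Rightarrow> 'a \<Rightarrow> real \<Rightarrow> nat \<Rightarrow> real" where
  "observed_path \<mu> q \<sigma> u0 w T N \<theta> \<omega> =
     (\<lambda>t\<in>{0..T}. \<lambda>k\<in>{1..N}. fourier_mode \<mu> q \<sigma> u0 w \<theta> k t \<omega>)"

definition tendsto_zero_in_prob :: "'a measure \<Rightarrow> (nat \<Rightarrow> 'a \<Rightarrow> real) \<Rightarrow> bool" where
  "tendsto_zero_in_prob M X \<longleftrightarrow>
     (\<forall>\<epsilon>>0. (\<lambda>n. measure M {\<omega> \<in> space M. \<bar>X n \<omega>\<bar> > \<epsilon>}) \<longlonglongrightarrow> 0)"

text \<open>
  Uniform asymptotic normality (Ibragimov--Khasminskii) of the family of laws of the observations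
  \<open>U N \<theta> :: 'a \<Rightarrow> 'x\<close>, \<open>\<theta> > 0\<close>, in the measurable space \<open>S N\<close>. The observations for all \<open>N\<close> and
  \<open>\<theta>\<close> live on the common probability space \<open>M\<close>; only indices \<open>N \<ge> 1\<close> are considered.

  \<open>RN_deriv P Q\<close> is the density \<open>dQ/dP\<close>; it is the zero function when \<open>Q\<close> has no density with
  respect to \<open>P\<close>, so the representation as an exponential includes \<open>Q \<lless> P\<close>. The variable
  \<open>\<Delta> N \<theta>\<close> is a measurable function of the observation, chosen before the sequences
  \<open>\<eta>\<^sub>N \<rightarrow> \<eta>\<close> and hence independent of them.
\<close>

definition law :: "'a measure \<Rightarrow> (nat \<Rightarrow> 'x measure) \<Rightarrow> (nat \<Rightarrow> real \<Rightarrow> 'a \<Rightarrow> 'x) \<Rightarrow>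
    nat \<Rightarrow> real \<Rightarrow> 'x measure" where
  "law M S U N \<theta> = distr M (S N) (U N \<theta>)"

definition uniformly_asymptotically_normal ::
  "'a measure \<Rightarrow> (nat \<Rightarrow> 'x measure) \<Rightarrow> (nat \<Rightarrow> real \<Rightarrow> 'a \<Rightarrow> 'x) \<Rightarrow> bool" where
  "uniformly_asymptotically_normal M S U \<longleftrightarrow>
     (\<exists>(\<phi> :: nat \<Rightarrow> real \<Rightarrow> real) (\<Delta> :: nat \<Rightarrow> real \<Rightarrow> 'x \<Rightarrow> real).
        (\<forall>N\<ge>1. \<forall>\<theta>>0. \<phi> N \<theta> \<noteq> 0) \<and>
        (\<forall>N\<ge>1. \<forall>\<theta>>0. \<Delta> N \<theta> \<in> borel_measurable (S N)) \<and>
        (\<forall>(\<theta>0 :: nat \<Rightarrow> real) (h :: nat \<Rightarrow> real) (\<eta> :: real).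
           (\<forall>N\<ge>1. \<theta>0 N > 0) \<longrightarrow> h \<longlonglongrightarrow> \<eta> \<longrightarrow>
           (\<forall>N\<ge>1. \<theta>0 N + \<phi> N (\<theta>0 N) * h N > 0) \<longrightarrow>
           (\<exists>\<Psi> :: nat \<Rightarrow> 'a \<Rightarrow> real.
              (\<forall>N\<ge>1. \<Psi> N \<in> borel_measurable M) \<and>
              (\<forall>N\<ge>1. AE \<omega> in M.
                 RN_deriv (law M S U N (\<theta>0 N)) (law M S U N (\<theta>0 N + \<phi> N (\<theta>0 N) * h N))
                   (U N (\<theta>0 N) \<omega>)
                 = ennreal (exp (\<eta> * \<Delta> N (\<theta>0 N) (U N (\<theta>0 N) \<omega>) - \<eta>\<^sup>2 / 2 + \<Psi> N \<omega>))) \<and>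
              tendsto_zero_in_prob M \<Psi>) \<and>
           weak_conv_m (\<lambda>N. distr M borel (\<lambda>\<omega>. \<Delta> N (\<theta>0 N) (U N (\<theta>0 N) \<omega>)))
             std_normal_distribution))"

end

theory Submission
  imports Defs
begin

text \<open>
  In each mode, \<open>ln (u\<^sub>k t / u\<^sub>k 0)\<close> is a multiple of \<open>w\<^sub>k t - w\<^sub>k 0\<close> plus a linear function of \<open>t\<close>, whose
  slope is \<open>- \<theta> \<mu>\<^sub>k\<close> up to a constant that does not depend on \<open>\<theta>\<close>. Changing the
  parameter from \<open>\<theta>\<close> to \<open>\<theta>'\<close> is therefore the same as adding the constant drift
  \<open>c\<^sub>k = (\<theta> - \<theta>') \<mu>\<^sub>k / (\<sigma> q\<^sub>k)\<close> to \<open>w\<^sub>k\<close>, and Girsanov's theorem gives the law for \<open>\<theta>'\<close> the density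
  \<open>exp (\<Sum>\<^sub>k c\<^sub>k (w\<^sub>k T - w\<^sub>k 0) - c\<^sub>k\<^sup>2 T / 2)\<close> with respect to the law for \<open>\<theta>\<close>. With the normalising
  factor \<open>\<phi> N = \<sigma> / sqrt (T \<Sum>\<^sub>k \<mu>\<^sub>k\<^sup>2 / q\<^sub>k\<^sup>2)\<close>, the choice \<open>\<theta>' = \<theta> + \<phi> N h\<close> turns the logarithm of this
  density into \<open>h \<Delta> - h\<^sup>2 / 2\<close>, where \<open>\<Delta>\<close> is a normalised linear combination of independent
  centred normal variables and so has the law \<open>N(0,1)\<close> for every \<open>N\<close>. If \<open>h\<^sub>N\<close> tends to \<open>\<eta>\<close>, the
  remainder \<open>(h\<^sub>N - \<eta>) \<Delta> - (h\<^sub>N\<^sup>2 - \<eta>\<^sup>2) / 2\<close> tends to zero in probability, because the law of \<open>\<Delta>\<close>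
  does not change.

  The drift is constant in time, so no stochastic calculus enters Girsanov's theorem. On a finite
  grid of times the increments are independent of each other and of the initial values
  (\<open>nn_integral_initial_times_increments\<close>). For one normal variable the shift formula is a
  completed square (\<open>normal_shift_nn_integral\<close>), and the exponential weights of the single
  increments multiply to the density above. This identifies the joint law of initial values and
  drifted increments (\<open>distr_drifted_increments\<close>), hence the law of the paths on cylinder sets
  (\<open>distr_all_paths_girsanov\<close>). Finally, \<open>w\<^sub>k T - w\<^sub>k 0\<close> is recovered from the observed path, which
  makes the density and \<open>\<Delta>\<close> functions of the observation (\<open>law_eq_density\<close>,
  \<open>likelihood_ratio_local\<close>, \<open>distr_normalized_score\<close>).
\<close>

section \<open>Shifted normal variables and convergence in probability\<close>

text \<open>
  The one-dimensional case of Girsanov's theorem. Translation of the Lebesgue integral moves the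
  shift from \<open>f\<close> into the normal density, and completing the square shows that a shifted centred
  normal density is the original one times an exponential. The shift is written \<open>c * s\<^sup>2\<close> because
  drift \<open>c\<close> during a time of length \<open>s\<^sup>2\<close> produces it.
\<close>

lemma (in prob_space) normal_shift_nn_integral:
  fixes f :: "real \<Rightarrow> ennreal"
  assumes X: "distributed M lborel X (normal_density 0 s)" and s: "s > 0"
    and f [measurable]: "f \<in> borel_measurable borel"
  shows "(\<integral>\<^sup>+\<omega>. f (X \<omega> + c * s\<^sup>2) \<partial>M) = (\<integral>\<^sup>+\<omega>. f (X \<omega>) * exp (c * X \<omega> - c\<^sup>2 * s\<^sup>2 / 2) \<partial>M)"
proof -
  have tilt: "normal_density 0 s (y - c * s\<^sup>2) = normal_density 0 s y * exp (c * y - c\<^sup>2 * s\<^sup>2 / 2)" for y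
  proof -
    have "- (y - c * s\<^sup>2 - 0)\<^sup>2 / (2 * s\<^sup>2) = - (y - 0)\<^sup>2 / (2 * s\<^sup>2) + (c * y - c\<^sup>2 * s\<^sup>2 / 2)"
      using s by (simp add: field_simps power2_eq_square)
    then show ?thesis
      unfolding normal_density_def by (simp only: exp_add mult.assoc)
  qed
  have "(\<integral>\<^sup>+\<omega>. f (X \<omega> + c * s\<^sup>2) \<partial>M) = (\<integral>\<^sup>+x. normal_density 0 s x * f (x + c * s\<^sup>2) \<partial>lborel)"
    using distributed_nn_integral[OF X, of "\<lambda>x. f (x + c * s\<^sup>2)"] by simp
  also have "\<dots> = (\<integral>\<^sup>+y. normal_density 0 s (y - c * s\<^sup>2) * f y \<partial>lborel)"
    by (subst nn_integral_real_affine[of _ 1 "- (c * s\<^sup>2)"])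
       (auto simp: add.commute mult.commute)
  also have "\<dots> = (\<integral>\<^sup>+y. normal_density 0 s y * (f y * exp (c * y - c\<^sup>2 * s\<^sup>2 / 2)) \<partial>lborel)"
    by (simp add: tilt ennreal_mult' ac_simps)
  also have "\<dots> = (\<integral>\<^sup>+\<omega>. f (X \<omega>) * exp (c * X \<omega> - c\<^sup>2 * s\<^sup>2 / 2) \<partial>M)"
    using distributed_nn_integral[OF X, of "\<lambda>y. f y * exp (c * y - c\<^sup>2 * s\<^sup>2 / 2)"] by simp
  finally show ?thesis .
qed

text \<open>
  Variables with one common integrable law are bounded in \<open>L\<^sup>1\<close>, so by Markov's inequality vanishing
  coefficients suffice. The index \<open>0\<close> is excluded because the statistical model starts with one
  observed mode.
\<close>

lemma (in prob_space) tendsto_zero_in_prob_affine: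
  assumes distr: "\<And>n. n \<ge> 1 \<Longrightarrow> distr M borel (X n) = \<nu>"
    and X: "\<And>n. n \<ge> 1 \<Longrightarrow> X n \<in> borel_measurable M"
    and int: "integrable \<nu> (\<lambda>x::real. x)"
    and a: "a \<longlonglongrightarrow> 0" and b: "b \<longlonglongrightarrow> 0"
  shows "tendsto_zero_in_prob M (\<lambda>n \<omega>. a n * X n \<omega> + b n)"
  unfolding tendsto_zero_in_prob_def
proof (intro allI impI)
  fix \<epsilon> :: real assume \<epsilon>: "\<epsilon> > 0"
  define C where "C = (\<integral>x. \<bar>x\<bar> \<partial>\<nu>)"
  have bound: "measure M {\<omega> \<in> space M. \<bar>a n * X n \<omega> + b n\<bar> > \<epsilon>} \<le> (\<bar>a n\<bar> * C + \<bar>b n\<bar>) / \<epsilon>"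
    if n: "n \<ge> 1" for n
  proof -
    note [measurable] = X[OF n]
    have "integrable M (\<lambda>\<omega>. X n \<omega>)"
      using int unfolding distr[OF n, symmetric] by (subst (asm) integrable_distr_eq) auto
    then have intX: "integrable M (\<lambda>\<omega>. \<bar>X n \<omega>\<bar>)" by simp
    have EX: "(\<integral>\<omega>. \<bar>X n \<omega>\<bar> \<partial>M) = C"
      unfolding C_def distr[OF n, symmetric] by (subst integral_distr) auto
    have "measure M {\<omega> \<in> space M. \<bar>a n * X n \<omega> + b n\<bar> > \<epsilon>}
        \<le> measure M {\<omega> \<in> space M. \<bar>a n\<bar> * \<bar>X n \<omega>\<bar> + \<bar>b n\<bar> \<ge> \<epsilon>}"
    proof (rule finite_measure_mono)
      show "{\<omega> \<in> space M. \<bar>a n * X n \<omega> + b n\<bar> > \<epsilon>} \<subseteq> {\<omega> \<in> space M. \<bar>a n\<bar> * \<bar>X n \<omega>\<bar> + \<bar>b n\<bar> \<ge> \<epsilon>}"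
      proof safe
        fix \<omega> assume "\<bar>a n * X n \<omega> + b n\<bar> > \<epsilon>"
        then show "\<bar>a n\<bar> * \<bar>X n \<omega>\<bar> + \<bar>b n\<bar> \<ge> \<epsilon>"
          using abs_triangle_ineq[of "a n * X n \<omega>" "b n"] by (simp add: abs_mult)
      qed
    qed measurable
    also have "\<dots> \<le> (\<integral>\<omega>. \<bar>a n\<bar> * \<bar>X n \<omega>\<bar> + \<bar>b n\<bar> \<partial>M) / \<epsilon>"
      by (rule integral_Markov_inequality_measure[where A = "space M"]) (use intX \<epsilon> in auto)
    also have "(\<integral>\<omega>. \<bar>a n\<bar> * \<bar>X n \<omega>\<bar> + \<bar>b n\<bar> \<partial>M) = \<bar>a n\<bar> * C + \<bar>b n\<bar>"
      using intX EX by (simp add: prob_space)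
    finally show ?thesis .
  qed
  have "(\<lambda>n. (\<bar>a n\<bar> * C + \<bar>b n\<bar>) / \<epsilon>) \<longlonglongrightarrow> (\<bar>0\<bar> * C + \<bar>0\<bar>) / \<epsilon>"
    using \<epsilon> by (intro tendsto_intros a b) auto
  then have lim: "(\<lambda>n. (\<bar>a n\<bar> * C + \<bar>b n\<bar>) / \<epsilon>) \<longlonglongrightarrow> 0" by simp
  show "(\<lambda>n. measure M {\<omega> \<in> space M. \<bar>a n * X n \<omega> + b n\<bar> > \<epsilon>}) \<longlonglongrightarrow> 0"
    by (rule tendsto_sandwich[OF _ _ tendsto_const lim])
       (simp, rule eventually_sequentiallyI[of 1], rule bound)
qed

section \<open>Finite time grids\<close>

lemma mono_on_grid:
  fixes t :: "nat \<Rightarrow> 'b::order"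
  assumes "\<And>i. i < n \<Longrightarrow> t i < t (Suc i)" "i \<le> j" "j \<le> n"
  shows "t i \<le> t j"
  using assms(2,3)
proof (induction j rule: dec_induct)
  case (step j)
  then show ?case using assms(1)[of j] by (auto intro: order_trans less_imp_le)
qed simp

text \<open>
  Cylinder sets use arbitrary finite sets of times, whereas the increments need an increasing
  enumeration that starts at \<open>0\<close> and ends at the horizon \<open>T\<close> of the density.
\<close>

lemma finite_subset_of_grid:
  fixes J :: "real set"
  assumes "finite J" "J \<subseteq> {0..T}" "0 < T"
  shows "\<exists>n t. t 0 = 0 \<and> t n = T \<and> (\<forall>i<n. t i < t (Suc i)) \<and> J \<subseteq> t ` {..n::nat}"
proof -
  define K where "K = insert 0 (insert T J)"
  define xs where "xs = sorted_list_of_set K"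
  define n where "n = length xs - 1"
  have K: "finite K" "K \<noteq> {}"
    using assms by (auto simp: K_def)
  have ends: "Min K = 0" "Max K = T"
    by (rule Min_eqI Max_eqI; use assms in \<open>auto simp: K_def\<close>)+
  have xs: "set xs = K" "sorted_wrt (<) xs" "xs \<noteq> []"
    using K by (auto simp: xs_def)
  have less: "xs ! i < xs ! j" if "i < j" "j < length xs" for i j
    using xs(2) that by (simp add: sorted_wrt_iff_nth_less)
  have len: "Suc n = length xs" using xs(3) by (simp add: n_def)
  have mono: "xs ! i \<le> xs ! j" if "i \<le> j" "j \<le> n" for i j
    using less[of i j] that len by (cases "i = j") auto
  have nth: "\<exists>i\<le>n. xs ! i = s" if "s \<in> K" for s
    using that xs(1) len by (metis in_set_conv_nth less_Suc_eq_le)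
  have in_K: "xs ! i \<in> K" if "i \<le> n" for i
    using that xs(1) len by (metis less_Suc_eq_le nth_mem)
  have "xs ! 0 = Min K"
  proof (rule Min_eqI[symmetric])
    fix s assume "s \<in> K"
    then obtain i where "i \<le> n" "xs ! i = s" using nth by auto
    then show "xs ! 0 \<le> s" using mono[of 0 i] by simp
  qed (use K in_K in auto)
  moreover have "xs ! n = Max K"
  proof (rule Max_eqI[symmetric])
    fix s assume "s \<in> K"
    then obtain i where "i \<le> n" "xs ! i = s" using nth by auto
    then show "s \<le> xs ! n" using mono[of i n] by simp
  qed (use K in_K in auto)
  moreover have "J \<subseteq> (!) xs ` {..n}"
  proof
    fix s assume "s \<in> J"
    then obtain i where "i \<le> n" "xs ! i = s" using nth[of s] by (auto simp: K_def)
    then show "s \<in> (!) xs ` {..n}" by auto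
  qed
  ultimately show ?thesis
    using ends less len by (intro exI[of _ n] exI[of _ "(!) xs"]) auto
qed

section \<open>Increments of Brownian motions\<close>

locale brownian_basis = stochastic_basis M F for M :: "'a measure" and F +
  fixes w :: "nat \<Rightarrow> real \<Rightarrow> 'a \<Rightarrow> real"
  assumes brownian: "independent_brownian_motions w"
begin

lemma space_F [simp]: "0 \<le> t \<Longrightarrow> space (F t) = space M"
  using subalgebra by (auto simp: subalgebra_def)

lemma measurable_later:
  assumes "f \<in> measurable (F s) N" "0 \<le> s" "s \<le> t" shows "f \<in> measurable (F t) N"
  using assms filtration_mono[of s t] by (auto simp: measurable_def)

lemma measurable_from_F:
  assumes "f \<in> measurable (F s) N" "0 \<le> s" shows "f \<in> measurable M N"
  using assms subalgebra by (auto intro: measurable_from_subalg)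

lemma w_adapted: "k \<ge> 1 \<Longrightarrow> 0 \<le> t \<Longrightarrow> w k t \<in> borel_measurable (F t)"
  using brownian by (simp add: independent_brownian_motions_def)

lemma w_measurable: "k \<ge> 1 \<Longrightarrow> 0 \<le> t \<Longrightarrow> w k t \<in> borel_measurable M"
  using w_adapted measurable_from_F by blast

lemma w_continuous: "k \<ge> 1 \<Longrightarrow> \<omega> \<in> space M \<Longrightarrow> continuous_on {0..} (\<lambda>t. w k t \<omega>)"
  using brownian by (simp add: independent_brownian_motions_def)

lemma increment_normal:
  "k \<ge> 1 \<Longrightarrow> 0 \<le> s \<Longrightarrow> s < t \<Longrightarrow>
     distributed M lborel (\<lambda>\<omega>. w k t \<omega> - w k s \<omega>) (normal_density 0 (sqrt (t - s)))"
  using brownian by (simp add: independent_brownian_motions_def)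

text \<open>
  Index \<open>0\<close> carries the past up to time \<open>s\<close> and index \<open>k \<ge> 1\<close> the increment of \<open>w k\<close>. The value
  type is arbitrary since the increments serve both in integrals of nonnegative functions and in
  sums of real random variables.
\<close>

lemma indep_vars_past_and_increments:
  fixes G :: "'a \<Rightarrow> 'b::topological_space" and g :: "nat \<Rightarrow> real \<Rightarrow> 'b"
  assumes st: "0 \<le> s" "s \<le> t" and G: "G \<in> borel_measurable (F s)"
    and g: "\<And>k. k \<ge> 1 \<Longrightarrow> g k \<in> borel_measurable borel"
  shows "indep_vars (\<lambda>_. borel) (\<lambda>k \<omega>. if k = 0 then G \<omega> else g k (w k t \<omega> - w k s \<omega>)) UNIV"
  unfolding indep_vars_def2
proof (intro conjI ballI)
  fix k :: nat
  show "(\<lambda>\<omega>. if k = 0 then G \<omega> else g k (w k t \<omega> - w k s \<omega>)) \<in> borel_measurable M"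
    using g[of k] measurable_from_F[OF G] w_measurable[of k s] w_measurable[of k t] st
    by (cases "k = 0") (auto intro!: measurable_compose[OF _ g])
next
  have indep: "indep_sets (\<lambda>k. if k = 0 then sets (F s)
               else {(\<lambda>\<omega>. w k t \<omega> - w k s \<omega>) -` B \<inter> space M | B. B \<in> sets borel}) UNIV"
    using brownian st by (simp add: independent_brownian_motions_def)
  show "indep_sets (\<lambda>k. {(\<lambda>\<omega>. if k = 0 then G \<omega> else g k (w k t \<omega> - w k s \<omega>)) -` A \<inter> space M | A. A \<in> sets borel}) UNIV"
  proof (rule indep_sets_mono_sets[OF indep], intro subsetI)
    fix k :: nat and E
    assume "E \<in> {(\<lambda>\<omega>. if k = 0 then G \<omega> else g k (w k t \<omega> - w k s \<omega>)) -` A \<inter> space M | A. A \<in> sets borel}"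
    then obtain A where A: "A \<in> sets borel"
      and E: "E = (\<lambda>\<omega>. if k = 0 then G \<omega> else g k (w k t \<omega> - w k s \<omega>)) -` A \<inter> space M" by auto
    show "E \<in> (if k = 0 then sets (F s)
               else {(\<lambda>\<omega>. w k t \<omega> - w k s \<omega>) -` B \<inter> space M | B. B \<in> sets borel})"
    proof (cases "k = 0")
      case True
      then show ?thesis
        using measurable_sets[OF G A] st E by simp
    next
      case False
      then have "E = (\<lambda>\<omega>. w k t \<omega> - w k s \<omega>) -` (g k -` A) \<inter> space M" and "g k -` A \<in> sets borel"
        using E measurable_sets[OF g A, of k] by auto
      with False show ?thesis by auto
    qed
  qed
qed

lemma nn_integral_past_times_increments:
  fixes G :: "'a \<Rightarrow> ennreal" and g :: "nat \<Rightarrow> real \<Rightarrow> ennreal"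
  assumes st: "0 \<le> s" "s \<le> t" and G: "G \<in> borel_measurable (F s)"
    and g: "\<And>k. k \<ge> 1 \<Longrightarrow> g k \<in> borel_measurable borel"
  shows "(\<integral>\<^sup>+\<omega>. G \<omega> * (\<Prod>k=1..N. g k (w k t \<omega> - w k s \<omega>)) \<partial>M)
       = (\<integral>\<^sup>+\<omega>. G \<omega> \<partial>M) * (\<Prod>k=1..N. \<integral>\<^sup>+\<omega>. g k (w k t \<omega> - w k s \<omega>) \<partial>M)"
proof -
  let ?X = "\<lambda>k \<omega>. if k = 0 then G \<omega> else g k (w k t \<omega> - w k s \<omega>)"
  have "indep_vars (\<lambda>_. borel) ?X {0..N}"
    using indep_vars_past_and_increments[OF assms] by (rule indep_vars_subset) auto
  then have "(\<integral>\<^sup>+\<omega>. (\<Prod>k=0..N. ?X k \<omega>) \<partial>M) = (\<Prod>k=0..N. \<integral>\<^sup>+\<omega>. ?X k \<omega> \<partial>M)"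
    by (intro indep_vars_nn_integral) auto
  then show ?thesis
    by (simp add: prod.atLeast_Suc_atMost)
qed

text \<open>
  Induction along the grid: everything up to \<open>t n\<close> is measurable with respect to \<open>F (t n)\<close> and
  plays the part of the past when the increments over the next interval are split off.
\<close>

lemma nn_integral_initial_times_increments:
  fixes G :: "'a \<Rightarrow> ennreal" and g :: "nat \<Rightarrow> nat \<Rightarrow> real \<Rightarrow> ennreal"
  assumes t: "t 0 = 0" "\<And>i. i < n \<Longrightarrow> t i < t (Suc i)" and G: "G \<in> borel_measurable (F 0)"
    and g: "\<And>i k. k \<ge> 1 \<Longrightarrow> g i k \<in> borel_measurable borel"
  shows "(\<integral>\<^sup>+\<omega>. G \<omega> * (\<Prod>i<n. \<Prod>k=1..N. g i k (w k (t (Suc i)) \<omega> - w k (t i) \<omega>)) \<partial>M)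
       = (\<integral>\<^sup>+\<omega>. G \<omega> \<partial>M) * (\<Prod>i<n. \<Prod>k=1..N. \<integral>\<^sup>+\<omega>. g i k (w k (t (Suc i)) \<omega> - w k (t i) \<omega>) \<partial>M)"
  using t(2)
proof (induction n)
  case 0
  then show ?case by simp
next
  case (Suc n)
  have mono: "t i \<le> t j" if "i \<le> j" "j \<le> Suc n" for i j
    using mono_on_grid[of "Suc n" t i j] Suc.prems that by simp
  have nonneg: "0 \<le> t i" if "i \<le> Suc n" for i
    using mono[of 0 i] that t(1) by simp
  let ?G = "\<lambda>\<omega>. G \<omega> * (\<Prod>i<n. \<Prod>k=1..N. g i k (w k (t (Suc i)) \<omega> - w k (t i) \<omega>))"
  have past: "?G \<in> borel_measurable (F (t n))"
  proof (intro borel_measurable_times_ennreal borel_measurable_prod_ennreal)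
    show "G \<in> borel_measurable (F (t n))"
      using measurable_later[OF G, of "t n"] nonneg by simp
    fix i k assume ik: "i \<in> {..<n}" "k \<in> {1..N}"
    then have "w k (t (Suc i)) \<in> borel_measurable (F (t n))" "w k (t i) \<in> borel_measurable (F (t n))"
      using measurable_later[OF w_adapted] nonneg mono by auto
    then show "(\<lambda>\<omega>. g i k (w k (t (Suc i)) \<omega> - w k (t i) \<omega>)) \<in> borel_measurable (F (t n))"
      using ik by (intro measurable_compose[OF _ g]) auto
  qed
  show ?case
    using nn_integral_past_times_increments[OF _ _ past, of "t (Suc n)" "g n" N]
      Suc nonneg mono[of n "Suc n"] g by (simp add: mult.assoc)
qed

section \<open>Girsanov's formula for a constant drift\<close>

text \<open>
  The increments over the grid \<open>t\<close> of the processes with drift \<open>c k\<close> added to \<open>w k\<close>. The initial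
  data occupy the row with index \<open>0\<close>, so that one product space holds everything that
  determines the observation at the grid points.
\<close>

fun drifted_increments ::
  "(nat \<Rightarrow> 'a \<Rightarrow> real) \<Rightarrow> (nat \<Rightarrow> real) \<Rightarrow> (nat \<Rightarrow> real) \<Rightarrow> nat \<times> nat \<Rightarrow> 'a \<Rightarrow> real" where
  "drifted_increments X t c (0, k) \<omega> = X k \<omega>"
| "drifted_increments X t c (Suc i, k) \<omega> =
     w k (t (Suc i)) \<omega> - w k (t i) \<omega> + c k * (t (Suc i) - t i)"

definition girsanov_density :: "nat \<Rightarrow> (nat \<Rightarrow> real) \<Rightarrow> real \<Rightarrow> 'a \<Rightarrow> real" where
  "girsanov_density N c T \<omega> = exp (\<Sum>k=1..N. c k * (w k T \<omega> - w k 0 \<omega>) - (c k)\<^sup>2 * T / 2)"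

lemma girsanov_density_measurable:
  "0 \<le> T \<Longrightarrow> girsanov_density N c T \<in> borel_measurable M"
  unfolding girsanov_density_def[abs_def] using w_measurable[of _ T] w_measurable[of _ 0] by simp

lemma drifted_increments_measurable:
  assumes "\<And>k. k \<ge> 1 \<Longrightarrow> X k \<in> borel_measurable M" "\<And>i. i \<le> n \<Longrightarrow> 0 \<le> t i"
    and "p \<in> {..n} \<times> {1..N}"
  shows "drifted_increments X t c p \<in> borel_measurable M"
proof -
  obtain j k where p: "p = (j, k)" by (cases p)
  show ?thesis
  proof (cases j)
    case 0
    then have "drifted_increments X t c p = X k" using p by (auto simp: fun_eq_iff)
    then show ?thesis using assms p by simp
  next
    case (Suc i)
    then have "w k (t (Suc i)) \<in> borel_measurable M" "w k (t i) \<in> borel_measurable M"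
      using assms p by (auto intro!: w_measurable)
    moreover have "drifted_increments X t c p
        = (\<lambda>\<omega>. w k (t (Suc i)) \<omega> - w k (t i) \<omega> + c k * (t (Suc i) - t i))"
      using Suc p by (auto simp: fun_eq_iff)
    ultimately show ?thesis by simp
  qed
qed

text \<open>
  The exponent is linear in the increment and in the elapsed time, so it telescopes along any grid
  from \<open>0\<close> to \<open>T\<close>. Hence the single density at time \<open>T\<close> acts as one exponential weight on each
  increment.
\<close>

lemma girsanov_density_eq_prod:
  assumes t: "t 0 = 0" "t n = T"
  shows "ennreal (girsanov_density N c T \<omega>)
    = (\<Prod>i<n. \<Prod>k=1..N. ennreal (exp (c k * (w k (t (Suc i)) \<omega> - w k (t i) \<omega>)
          - (c k)\<^sup>2 * (t (Suc i) - t i) / 2)))"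
proof -
  have tele: "w k T \<omega> - w k 0 \<omega> = (\<Sum>i<n. w k (t (Suc i)) \<omega> - w k (t i) \<omega>)"
    "T = (\<Sum>i<n. t (Suc i) - t i)" for k
    using sum_lessThan_telescope[of "\<lambda>i. w k (t i) \<omega>" n] sum_lessThan_telescope[of t n] t by auto
  have split: "a * (\<Sum>i<n. x i) - b * (\<Sum>i<n. y i) / 2 = (\<Sum>i<n. a * x i - b * y i / 2)"
    for a b :: real and x y :: "nat \<Rightarrow> real"
    by (simp add: sum_subtractf sum_distrib_left sum_divide_distrib)
  have "(\<Sum>k=1..N. c k * (w k T \<omega> - w k 0 \<omega>) - (c k)\<^sup>2 * T / 2)
      = (\<Sum>k=1..N. \<Sum>i<n. c k * (w k (t (Suc i)) \<omega> - w k (t i) \<omega>) - (c k)\<^sup>2 * (t (Suc i) - t i) / 2)"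
    unfolding tele(1) by (subst tele(2)) (simp only: split)
  also have "\<dots> = (\<Sum>i<n. \<Sum>k=1..N. c k * (w k (t (Suc i)) \<omega> - w k (t i) \<omega>) - (c k)\<^sup>2 * (t (Suc i) - t i) / 2)"
    by (rule sum.swap)
  finally show ?thesis
    unfolding girsanov_density_def by (simp add: exp_sum prod_ennreal prod_nonneg)
qed

text \<open>
  Girsanov's formula for product functions. Both sides factorise over the increments, and the
  factors agree by the shift formula for a single normal variable.
\<close>

lemma nn_integral_drifted_increments:
  fixes g :: "nat \<Rightarrow> nat \<Rightarrow> real \<Rightarrow> ennreal"
  assumes t: "t 0 = 0" "t n = T" "\<And>i. i < n \<Longrightarrow> t i < t (Suc i)"
    and G: "G \<in> borel_measurable (F 0)"
    and g: "\<And>i k. k \<ge> 1 \<Longrightarrow> g i k \<in> borel_measurable borel"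
  shows "(\<integral>\<^sup>+\<omega>. G \<omega> * (\<Prod>i<n. \<Prod>k=1..N.
             g i k (w k (t (Suc i)) \<omega> - w k (t i) \<omega> + c k * (t (Suc i) - t i))) \<partial>M)
       = (\<integral>\<^sup>+\<omega>. girsanov_density N c T \<omega> * (G \<omega> * (\<Prod>i<n. \<Prod>k=1..N.
             g i k (w k (t (Suc i)) \<omega> - w k (t i) \<omega>))) \<partial>M)"
proof -
  define D where "D i k \<omega> = w k (t (Suc i)) \<omega> - w k (t i) \<omega>" for i k \<omega>
  define e where "e i k x = ennreal (exp (c k * x - (c k)\<^sup>2 * (t (Suc i) - t i) / 2))" for i k x
  have nonneg: "0 \<le> t i" if "i \<le> n" for i
    using mono_on_grid[of n t 0 i] t that by simp
  have shift: "(\<integral>\<^sup>+\<omega>. g i k (D i k \<omega> + c k * (t (Suc i) - t i)) \<partial>M)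
      = (\<integral>\<^sup>+\<omega>. g i k (D i k \<omega>) * e i k (D i k \<omega>) \<partial>M)" if "i < n" "k \<in> {1..N}" for i k
    using normal_shift_nn_integral[OF increment_normal[of k "t i" "t (Suc i)"], of "g i k" "c k"]
      that t(3)[of i] nonneg[of i] g[of k i] by (simp add: D_def e_def)
  have "(\<integral>\<^sup>+\<omega>. G \<omega> * (\<Prod>i<n. \<Prod>k=1..N. g i k (D i k \<omega> + c k * (t (Suc i) - t i))) \<partial>M)
      = (\<integral>\<^sup>+\<omega>. G \<omega> \<partial>M) * (\<Prod>i<n. \<Prod>k=1..N. \<integral>\<^sup>+\<omega>. g i k (D i k \<omega> + c k * (t (Suc i) - t i)) \<partial>M)"
    unfolding D_def
    by (rule nn_integral_initial_times_increments[where g = "\<lambda>i k x. g i k (x + c k * (t (Suc i) - t i))"])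
       (use t G in \<open>auto intro!: measurable_compose[OF _ g]\<close>)
  also have "\<dots> = (\<integral>\<^sup>+\<omega>. G \<omega> \<partial>M) * (\<Prod>i<n. \<Prod>k=1..N. \<integral>\<^sup>+\<omega>. g i k (D i k \<omega>) * e i k (D i k \<omega>) \<partial>M)"
    by (simp add: shift)
  also have "\<dots> = (\<integral>\<^sup>+\<omega>. G \<omega> * (\<Prod>i<n. \<Prod>k=1..N. g i k (D i k \<omega>) * e i k (D i k \<omega>)) \<partial>M)"
    unfolding D_def e_def
    by (rule nn_integral_initial_times_increments[symmetric,
          where g = "\<lambda>i k x. g i k x * ennreal (exp (c k * x - (c k)\<^sup>2 * (t (Suc i) - t i) / 2))"])
       (use t G g in auto)
  also have "\<dots> = (\<integral>\<^sup>+\<omega>. girsanov_density N c T \<omega> * (G \<omega> * (\<Prod>i<n. \<Prod>k=1..N. g i k (D i k \<omega>))) \<partial>M)"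
    by (intro nn_integral_cong)
       (simp add: girsanov_density_eq_prod[of t n, OF t(1,2)] D_def e_def prod.distrib ac_simps)
  finally show ?thesis by (simp add: D_def)
qed

text \<open>
  Product functions include the indicators of boxes, and boxes determine a finite measure on a
  finite product space.
\<close>

lemma distr_drifted_increments:
  fixes n N :: nat
  assumes t: "t 0 = 0" "t n = T" "\<And>i. i < n \<Longrightarrow> t i < t (Suc i)"
    and X: "\<And>k. k \<ge> 1 \<Longrightarrow> X k \<in> borel_measurable (F 0)"
  defines "I \<equiv> {..n} \<times> {1..N}"
  shows "distr M (Pi\<^sub>M I (\<lambda>_. borel)) (\<lambda>\<omega>. \<lambda>p\<in>I. drifted_increments X t c p \<omega>)
       = distr (density M (girsanov_density N c T)) (Pi\<^sub>M I (\<lambda>_. borel))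
           (\<lambda>\<omega>. \<lambda>p\<in>I. drifted_increments X t (\<lambda>_. 0) p \<omega>)"
    (is "?P = ?Q")
proof -
  have nonneg: "0 \<le> t i" if "i \<le> n" for i
    using mono_on_grid[of n t 0 i] t that by simp
  have T: "0 \<le> T" using nonneg[of n] t by simp
  have meas: "(\<lambda>\<omega>. \<lambda>p\<in>I. drifted_increments X t d p \<omega>) \<in> measurable M (Pi\<^sub>M I (\<lambda>_. borel))" for d
    unfolding I_def
    by (intro measurable_restrict drifted_increments_measurable nonneg)
       (use X in \<open>auto intro: measurable_from_F[where s = 0]\<close>)
  have fin: "finite I" by (simp add: I_def)
  have box: "indicator (Pi\<^sub>E I A) (\<lambda>p\<in>I. drifted_increments X t d p \<omega>)
      = (\<Prod>k=1..N. indicator (A (0, k)) (X k \<omega>))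
        * (\<Prod>i<n. \<Prod>k=1..N. indicator (A (Suc i, k)) (drifted_increments X t d (Suc i, k) \<omega>) :: ennreal)"
    for d A \<omega>
  proof -
    have "indicator (Pi\<^sub>E I A) (\<lambda>p\<in>I. drifted_increments X t d p \<omega>)
        = (\<Prod>p\<in>I. indicator (A p) (drifted_increments X t d p \<omega>) :: ennreal)"
      using fin by (auto simp: indicator_def PiE_iff prod_zero_iff)
    also have "\<dots> = (\<Prod>i<Suc n. \<Prod>k=1..N. indicator (A (i, k)) (drifted_increments X t d (i, k) \<omega>))"
      by (simp add: I_def prod.cartesian_product lessThan_Suc_atMost case_prod_unfold)
    finally show ?thesis by (simp add: prod.lessThan_Suc_shift del: prod.lessThan_Suc)
  qed
  show ?thesis
  proof (rule measure_eqI_PiM_finite[OF fin])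
    fix A assume "\<And>p. p \<in> I \<Longrightarrow> A p \<in> sets (borel :: real measure)"
    \<comment> \<open>Changing \<open>A\<close> outside \<open>I\<close> makes every factor a measurable function.\<close>
    define B where "B p = (if p \<in> I then A p else {})" for p
    have B: "B p \<in> sets borel" for p
      using \<open>\<And>p. p \<in> I \<Longrightarrow> A p \<in> sets borel\<close> by (simp add: B_def)
    have AB: "Pi\<^sub>E I A = Pi\<^sub>E I B"
      by (rule PiE_cong) (simp add: B_def)
    have S: "Pi\<^sub>E I B \<in> sets (Pi\<^sub>M I (\<lambda>_. borel))"
      using fin B by (intro sets_PiM_I_finite) auto
    let ?G = "\<lambda>\<omega>. \<Prod>k=1..N. indicator (B (0, k)) (X k \<omega>) :: ennreal"
    have G: "?G \<in> borel_measurable (F 0)"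
      using X B by (intro borel_measurable_prod_ennreal measurable_compose[OF X]) auto
    have "emeasure ?P (Pi\<^sub>E I B) = (\<integral>\<^sup>+\<omega>. indicator (Pi\<^sub>E I B) (\<lambda>p\<in>I. drifted_increments X t c p \<omega>) \<partial>M)"
      using S by (subst nn_integral_distr[OF meas, symmetric]) (auto simp: nn_integral_indicator)
    also have "\<dots> = (\<integral>\<^sup>+\<omega>. girsanov_density N c T \<omega> * (?G \<omega> * (\<Prod>i<n. \<Prod>k=1..N.
             indicator (B (Suc i, k)) (w k (t (Suc i)) \<omega> - w k (t i) \<omega>))) \<partial>M)"
      unfolding box drifted_increments.simps
      by (rule nn_integral_drifted_increments[OF t G, where g = "\<lambda>i k. indicator (B (Suc i, k))"])
         (use B in auto)
    also have "\<dots> = (\<integral>\<^sup>+\<omega>. ennreal (girsanov_density N c T \<omega>)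
          * (indicator (Pi\<^sub>E I B) (\<lambda>p\<in>I. drifted_increments X t (\<lambda>_. 0) p \<omega>) :: ennreal) \<partial>M)"
      unfolding box by simp
    also have "\<dots> = emeasure ?Q (Pi\<^sub>E I B)"
      using S meas[of "\<lambda>_. 0"] girsanov_density_measurable[OF T, of N c]
      by (subst nn_integral_density[symmetric], simp, measurable)
         (subst nn_integral_distr[symmetric, of _ _ "Pi\<^sub>M I (\<lambda>_. borel)"],
          auto simp: nn_integral_indicator measurable_def)
    finally show "emeasure ?P (Pi\<^sub>E I A) = emeasure ?Q (Pi\<^sub>E I A)" by (simp add: AB)
  next
    show "range (\<lambda>_::nat. Pi\<^sub>E I (\<lambda>_. UNIV)) \<subseteq> prod_algebra I (\<lambda>_. borel :: real measure)"
      using fin by (auto intro!: prod_algebraI_finite)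
    interpret P: prob_space ?P using meas by (rule prob_space_distr)
    show "emeasure ?P (Pi\<^sub>E I (\<lambda>_. UNIV)) \<noteq> \<infinity>" for i :: nat by simp
  qed (auto simp: space_PiM)
qed

end

section \<open>Change of parameter in the law of the modes\<close>

locale diagonal_diffusion = brownian_basis M F w for M :: "'a measure" and F w +
  fixes u0 :: "nat \<Rightarrow> 'a \<Rightarrow> real" and \<mu> q :: "nat \<Rightarrow> real" and \<sigma> T :: real
  assumes \<mu>_pos: "\<And>k. k \<ge> 1 \<Longrightarrow> \<mu> k > 0" and q_pos: "\<And>k. k \<ge> 1 \<Longrightarrow> q k > 0"
    and \<sigma>_pos: "\<sigma> > 0" and T_pos: "T > 0"
    and u0_measurable: "\<And>k. k \<ge> 1 \<Longrightarrow> u0 k \<in> borel_measurable (F 0)"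
    and u0_nonzero: "\<And>k. k \<ge> 1 \<Longrightarrow> AE \<omega> in M. u0 k \<omega> \<noteq> 0"
begin

abbreviation U :: "nat \<Rightarrow> real \<Rightarrow> 'a \<Rightarrow> real \<Rightarrow> nat \<Rightarrow> real" where
  "U \<equiv> observed_path \<mu> q \<sigma> u0 w T"

abbreviation all_paths :: "nat \<Rightarrow> (real \<Rightarrow> nat \<Rightarrow> real) measure" where
  "all_paths N \<equiv> Pi\<^sub>M {0..T} (\<lambda>_. Pi\<^sub>M {1..N} (\<lambda>_. borel))"

lemma fourier_mode_measurable:
  assumes "k \<ge> 1" "0 \<le> t" shows "fourier_mode \<mu> q \<sigma> u0 w \<theta> k t \<in> borel_measurable M"
  unfolding fourier_mode_def[abs_def]
  using w_measurable[OF assms] measurable_from_F[OF u0_measurable[OF assms(1)]] by simp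

lemma U_measurable_all_paths: "U N \<theta> \<in> measurable M (all_paths N)"
  unfolding observed_path_def[abs_def]
  by (intro measurable_restrict fourier_mode_measurable) auto

text \<open>
  Replacing \<open>\<theta>\<close> by \<open>\<theta>'\<close> in a mode amounts to adding this drift to its Brownian motion, because
  \<open>\<sigma> * q k * drift_change \<theta> \<theta>' k = (\<theta> - \<theta>') * \<mu> k\<close>.
\<close>

definition drift_change :: "real \<Rightarrow> real \<Rightarrow> nat \<Rightarrow> real" where
  "drift_change \<theta> \<theta>' k = (\<theta> - \<theta>') * \<mu> k / (\<sigma> * q k)"

text \<open>
  Laws of processes are determined by cylinder sets. The times of a cylinder set lie on a
  grid, and at grid points the modes with parameter \<open>\<theta>'\<close> are the same function of the initial values
  and drifted increments as the modes with parameter \<open>\<theta>\<close> are of the increments without drift.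
\<close>

lemma distr_all_paths_girsanov:
  "distr M (all_paths N) (U N \<theta>')
     = distr (density M (girsanov_density N (drift_change \<theta> \<theta>') T)) (all_paths N) (U N \<theta>)"
    (is "?P = ?Q")
proof (rule measure_eqI_PiM_infinite)
  interpret P: prob_space ?P using U_measurable_all_paths by (rule prob_space_distr)
  show "finite_measure ?P" by (rule P.finite_measure_axioms)
  let ?c = "drift_change \<theta> \<theta>'" and ?N = "Pi\<^sub>M {1..N} (\<lambda>_. borel :: real measure)"
  fix A :: "real \<Rightarrow> (nat \<Rightarrow> real) set" and J
  assume J: "finite J" "J \<subseteq> {0..T}" and A: "\<And>s. s \<in> J \<Longrightarrow> A s \<in> sets ?N"
  obtain n t where t: "t 0 = 0" "t n = T" "\<And>i. i < n \<Longrightarrow> t i < t (Suc i)" and cover: "J \<subseteq> t ` {..n::nat}"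
    using finite_subset_of_grid[OF J T_pos] by auto
  from cover have "\<forall>s\<in>J. \<exists>j. j \<le> n \<and> t j = s" by auto
  then obtain pos where pos: "\<And>s. s \<in> J \<Longrightarrow> pos s \<le> n" "\<And>s. s \<in> J \<Longrightarrow> t (pos s) = s"
    by metis
  define I where "I = {..n} \<times> {1..N}"
  \<comment> \<open>Only increments from time \<open>0\<close> on enter below, so \<open>w k 0\<close> joins the initial value.\<close>
  define X where "X k \<omega> = u0 k \<omega> * exp (\<sigma> * q k * w k 0 \<omega>)" for k \<omega>
  define Y where "Y c \<omega> = (\<lambda>p\<in>I. drifted_increments X t c p \<omega>)" for c \<omega>
  have X: "X k \<in> borel_measurable (F 0)" if "k \<ge> 1" for k
    unfolding X_def[abs_def] using u0_measurable[OF that] w_adapted[OF that, of 0] by simp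
  define path where "path y s = (\<lambda>k\<in>{1..N}. y (0, k)
      * exp (- (\<theta> * \<mu> k + \<sigma>\<^sup>2 * (q k)\<^sup>2 / 2) * s + \<sigma> * q k * (\<Sum>i<pos s. y (Suc i, k))))"
    for y :: "nat \<times> nat \<Rightarrow> real" and s
  have path_measurable: "(\<lambda>y. path y s) \<in> measurable (Pi\<^sub>M I (\<lambda>_. borel)) ?N" if "s \<in> J" for s
    unfolding path_def
  proof (rule measurable_restrict)
    fix k assume k: "k \<in> {1..N}"
    have coord: "(\<lambda>y. y (j, k)) \<in> borel_measurable (Pi\<^sub>M I (\<lambda>_. borel :: real measure))" if "j \<le> n" for j
      using that k by (intro measurable_component_singleton) (auto simp: I_def)
    have [measurable]: "(\<lambda>y. y (0, k)) \<in> borel_measurable (Pi\<^sub>M I (\<lambda>_. borel :: real measure))"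
      "(\<lambda>y. \<Sum>i<pos s. y (Suc i, k)) \<in> borel_measurable (Pi\<^sub>M I (\<lambda>_. borel :: real measure))"
      using coord pos(1)[OF \<open>s \<in> J\<close>] by (auto intro!: borel_measurable_sum)
    show "(\<lambda>y. y (0, k) * exp (- (\<theta> * \<mu> k + \<sigma>\<^sup>2 * (q k)\<^sup>2 / 2) * s
        + \<sigma> * q k * (\<Sum>i<pos s. y (Suc i, k)))) \<in> borel_measurable (Pi\<^sub>M I (\<lambda>_. borel))"
      by measurable
  qed
  define E where "E = {y \<in> space (Pi\<^sub>M I (\<lambda>_. borel)). \<forall>s\<in>J. path y s \<in> A s}"
  have E: "E \<in> sets (Pi\<^sub>M I (\<lambda>_. borel))"
    unfolding E_def
  proof (rule sets.sets_Collect_finite_All[OF _ J(1)])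
    fix s assume "s \<in> J"
    show "{y \<in> space (Pi\<^sub>M I (\<lambda>_. borel)). path y s \<in> A s} \<in> sets (Pi\<^sub>M I (\<lambda>_. borel))"
      using measurable_sets[OF path_measurable A, OF \<open>s \<in> J\<close> \<open>s \<in> J\<close>]
      by (simp add: vimage_def Int_def conj_commute)
  qed
  \<comment> \<open>\<open>path\<close> always carries the parameter \<open>\<theta>\<close>; a drift of the increments turns it into \<open>\<theta>'\<close>.\<close>
  have drift: "path (Y ?c \<omega>) s = U N \<theta>' \<omega> s" "path (Y (\<lambda>_. 0) \<omega>) s = U N \<theta> \<omega> s" if "s \<in> J" for \<omega> s
  proof -
    have incr: "(\<Sum>i<pos s. Y c \<omega> (Suc i, k)) = w k s \<omega> - w k 0 \<omega> + c k * s" if k: "k \<in> {1..N}" for c k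
    proof -
      have "(\<Sum>i<pos s. Y c \<omega> (Suc i, k))
          = (\<Sum>i<pos s. (w k (t (Suc i)) \<omega> - w k (t i) \<omega>) + c k * (t (Suc i) - t i))"
        using pos(1)[OF \<open>s \<in> J\<close>] k by (intro sum.cong) (auto simp: Y_def I_def)
      also have "\<dots> = (\<Sum>i<pos s. w k (t (Suc i)) \<omega> - w k (t i) \<omega>) + c k * (\<Sum>i<pos s. t (Suc i) - t i)"
        by (simp only: sum.distrib sum_distrib_left)
      also have "\<dots> = w k s \<omega> - w k 0 \<omega> + c k * s"
        using sum_lessThan_telescope[of "\<lambda>i. w k (t i) \<omega>" "pos s"] sum_lessThan_telescope[of t "pos s"]
          pos(2)[OF \<open>s \<in> J\<close>] t(1) by simp
      finally show ?thesis .
    qed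
    have val: "path (Y c \<omega>) s = (\<lambda>k\<in>{1..N}. u0 k \<omega> * exp (- (\<theta> * \<mu> k + \<sigma>\<^sup>2 * (q k)\<^sup>2 / 2) * s
        + \<sigma> * q k * (w k s \<omega> + c k * s)))" for c
      unfolding path_def
    proof (rule restrict_ext)
      fix k assume k: "k \<in> {1..N}"
      then have "Y c \<omega> (0, k) = u0 k \<omega> * exp (\<sigma> * q k * w k 0 \<omega>)"
        by (simp add: Y_def I_def X_def)
      then show "Y c \<omega> (0, k) * exp (- (\<theta> * \<mu> k + \<sigma>\<^sup>2 * (q k)\<^sup>2 / 2) * s
              + \<sigma> * q k * (\<Sum>i<pos s. Y c \<omega> (Suc i, k)))
          = u0 k \<omega> * exp (- (\<theta> * \<mu> k + \<sigma>\<^sup>2 * (q k)\<^sup>2 / 2) * s + \<sigma> * q k * (w k s \<omega> + c k * s))"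
        by (simp add: incr[OF k] mult.assoc mult_exp_exp) (simp add: algebra_simps)
    qed
    have "s \<in> {0..T}" using J that by auto
    then show "path (Y (\<lambda>_. 0) \<omega>) s = U N \<theta> \<omega> s"
      unfolding val observed_path_def fourier_mode_def by simp
    have "- (\<theta> * \<mu> k + \<sigma>\<^sup>2 * (q k)\<^sup>2 / 2) * s + \<sigma> * q k * (w k s \<omega> + ?c k * s)
        = - (\<theta>' * \<mu> k + \<sigma>\<^sup>2 * (q k)\<^sup>2 / 2) * s + \<sigma> * q k * w k s \<omega>" if "k \<in> {1..N}" for k
    proof -
      have "\<sigma> * q k * ?c k = (\<theta> - \<theta>') * \<mu> k"
        using q_pos[of k] \<sigma>_pos that by (simp add: drift_change_def)
      then have "\<sigma> * q k * (w k s \<omega> + ?c k * s) = \<sigma> * q k * w k s \<omega> + (\<theta> - \<theta>') * \<mu> k * s"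
        by (simp add: distrib_left mult.assoc[symmetric])
      then show ?thesis by (simp add: algebra_simps)
    qed
    then show "path (Y ?c \<omega>) s = U N \<theta>' \<omega> s"
      using \<open>s \<in> {0..T}\<close> unfolding val observed_path_def fourier_mode_def by (simp cong: restrict_cong)
  qed
  \<comment> \<open>The cylinder set \<open>?C\<close> of paths becomes the set \<open>E\<close> of families of increments.\<close>
  let ?C = "prod_emb {0..T} (\<lambda>_. ?N) J (Pi\<^sub>E J A)"
  have C: "?C \<in> sets (all_paths N)"
    using J A by (intro sets_PiM_I) auto
  have cyl: "U N \<theta>'' -` ?C \<inter> space M = Y c -` E \<inter> space M"
    if "\<And>\<omega> s. s \<in> J \<Longrightarrow> path (Y c \<omega>) s = U N \<theta>'' \<omega> s" for \<theta>'' c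
  proof -
    have "U N \<theta>'' \<omega> \<in> ?C \<longleftrightarrow> (\<forall>s\<in>J. U N \<theta>'' \<omega> s \<in> A s)" if "\<omega> \<in> space M" for \<omega>
      using measurable_space[OF U_measurable_all_paths that, of N \<theta>'']
      by (simp add: prod_emb_def restrict_PiE_iff space_PiM Pi_iff)
    moreover have "Y c \<omega> \<in> space (Pi\<^sub>M I (\<lambda>_. borel))" for \<omega>
      by (auto simp: Y_def space_PiM)
    ultimately show ?thesis using that by (auto simp: E_def)
  qed
  have Y: "Y c \<in> measurable M (Pi\<^sub>M I (\<lambda>_. borel))" for c
  proof -
    have "0 \<le> t i" if "i \<le> n" for i
      using mono_on_grid[of n t 0 i] t that by simp
    then show ?thesis
      unfolding Y_def[abs_def] I_def using X
      by (intro measurable_restrict drifted_increments_measurable) (auto intro: measurable_from_F[where s = 0])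
  qed
  have "emeasure ?P ?C = emeasure (distr M (Pi\<^sub>M I (\<lambda>_. borel)) (Y ?c)) E"
    unfolding emeasure_distr[OF U_measurable_all_paths C] emeasure_distr[OF Y E]
    using cyl[of ?c \<theta>', OF drift(1)] by (rule arg_cong)
  also have "\<dots> = emeasure (distr (density M (girsanov_density N ?c T)) (Pi\<^sub>M I (\<lambda>_. borel)) (Y (\<lambda>_. 0))) E"
    using distr_drifted_increments[OF t X, where N = N and c = ?c] by (simp add: Y_def[abs_def] I_def)
  also have "\<dots> = emeasure ?Q ?C"
  proof -
    have dens: "U N \<theta> \<in> measurable (density M (girsanov_density N ?c T)) (all_paths N)"
      "Y (\<lambda>_. 0) \<in> measurable (density M (girsanov_density N ?c T)) (Pi\<^sub>M I (\<lambda>_. borel))"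
      using U_measurable_all_paths Y by (simp_all only: measurable_density_eq1)
    show ?thesis
      unfolding emeasure_distr[OF dens(1) C] emeasure_distr[OF dens(2) E] space_density
      using cyl[of "\<lambda>_. 0" \<theta>, OF drift(2)] by (rule arg_cong[OF sym])
  qed
  finally show "emeasure ?P ?C = emeasure ?Q ?C" .
qed auto

section \<open>The likelihood ratio as a function of the observation\<close>

text \<open>
  The increment \<open>w k T - w k 0\<close> computed from an observed path: the ratio of the
  mode between times \<open>T\<close> and \<open>0\<close> has a logarithm that is affine in this increment.
\<close>

definition recovered_noise :: "real \<Rightarrow> nat \<Rightarrow> (real \<Rightarrow> nat \<Rightarrow> real) \<Rightarrow> real" where
  "recovered_noise \<theta> k x = (ln (x T k / x 0 k) + (\<theta> * \<mu> k + \<sigma>\<^sup>2 * (q k)\<^sup>2 / 2) * T) / (\<sigma> * q k)"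

text \<open>
  The initial value cancels in the ratio, which is where it has to be nonzero.
\<close>

lemma recovered_noise_U:
  "AE \<omega> in M. \<forall>k\<in>{1..N}. recovered_noise \<theta> k (U N \<theta> \<omega>) = w k T \<omega> - w k 0 \<omega>"
proof (rule AE_finite_allI)
  fix k assume k: "k \<in> {1..N}"
  from k have "AE \<omega> in M. u0 k \<omega> \<noteq> 0" using u0_nonzero by simp
  then show "AE \<omega> in M. recovered_noise \<theta> k (U N \<theta> \<omega>) = w k T \<omega> - w k 0 \<omega>"
  proof eventually_elim
    case (elim \<omega>)
    have "U N \<theta> \<omega> T k / U N \<theta> \<omega> 0 k
        = exp (- (\<theta> * \<mu> k + \<sigma>\<^sup>2 * (q k)\<^sup>2 / 2) * T + \<sigma> * q k * w k T \<omega> - \<sigma> * q k * w k 0 \<omega>)"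
      using elim k T_pos by (simp add: observed_path_def fourier_mode_def exp_diff)
    then have "ln (U N \<theta> \<omega> T k / U N \<theta> \<omega> 0 k)
        + (\<theta> * \<mu> k + \<sigma>\<^sup>2 * (q k)\<^sup>2 / 2) * T = (w k T \<omega> - w k 0 \<omega>) * (\<sigma> * q k)"
      by (simp add: algebra_simps)
    then show ?case
      using q_pos[of k] \<sigma>_pos k by (simp add: recovered_noise_def)
  qed
qed simp

lemma U_measurable: "U N \<theta> \<in> measurable M (path_space T N)"
  unfolding path_space_def
proof (rule measurable_restrict_space2[OF _ U_measurable_all_paths], rule funcsetI)
  fix \<omega> assume \<omega>: "\<omega> \<in> space M"
  have "continuous_on {0..T} (\<lambda>t. U N \<theta> \<omega> t k)" if k: "k \<in> {1..N}" for k
  proof -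
    have "continuous_on {0..T} (\<lambda>t. w k t \<omega>)"
      using w_continuous[of k \<omega>] k \<omega> by (auto intro: continuous_on_subset)
    then have "continuous_on {0..T} (\<lambda>t. fourier_mode \<mu> q \<sigma> u0 w \<theta> k t \<omega>)"
      unfolding fourier_mode_def by (intro continuous_intros)
    then show ?thesis
      by (rule continuous_on_eq) (use k in \<open>simp add: observed_path_def\<close>)
  qed
  then show "U N \<theta> \<omega> \<in> {x. \<forall>k\<in>{1..N}. continuous_on {0..T} (\<lambda>t. x t k)}" by simp
qed

lemma recovered_noise_measurable:
  assumes "k \<in> {1..N}"
  shows "recovered_noise \<theta> k \<in> borel_measurable (path_space T N)"
proof -
  have coord: "(\<lambda>x. x t k :: real) \<in> borel_measurable (all_paths N)" if "t \<in> {0..T}" for t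
  proof (rule measurable_compose[where f = "\<lambda>x. x t" and g = "\<lambda>x. x k"])
    show "(\<lambda>x. x t) \<in> measurable (all_paths N) (Pi\<^sub>M {1..N} (\<lambda>_. borel))"
      using that by (rule measurable_component_singleton)
    show "(\<lambda>x. x k) \<in> borel_measurable (Pi\<^sub>M {1..N} (\<lambda>_. borel))"
      using assms by (rule measurable_component_singleton)
  qed
  have [measurable]: "(\<lambda>x. x 0 k) \<in> borel_measurable (all_paths N)"
    "(\<lambda>x. x T k) \<in> borel_measurable (all_paths N)"
    using coord T_pos by auto
  have "recovered_noise \<theta> k \<in> borel_measurable (all_paths N)"
    unfolding recovered_noise_def[abs_def] by measurable
  then show ?thesis
    unfolding path_space_def by (rule measurable_restrict_space1)
qed

definition likelihood_ratio :: "nat \<Rightarrow> real \<Rightarrow> real \<Rightarrow> (real \<Rightarrow> nat \<Rightarrow> real) \<Rightarrow> real" where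
  "likelihood_ratio N \<theta> \<theta>' x = exp (\<Sum>k=1..N. drift_change \<theta> \<theta>' k * recovered_noise \<theta> k x
      - (drift_change \<theta> \<theta>' k)\<^sup>2 * T / 2)"

lemma likelihood_ratio_measurable:
  "likelihood_ratio N \<theta> \<theta>' \<in> borel_measurable (path_space T N)"
proof -
  have "(\<lambda>x. \<Sum>k=1..N. drift_change \<theta> \<theta>' k * recovered_noise \<theta> k x - (drift_change \<theta> \<theta>' k)\<^sup>2 * T / 2)
      \<in> borel_measurable (path_space T N)"
    using recovered_noise_measurable
    by (intro borel_measurable_sum borel_measurable_diff borel_measurable_times borel_measurable_const) auto
  then show ?thesis unfolding likelihood_ratio_def[abs_def] by measurable
qed

text \<open>
  The Girsanov density is almost surely a function of the observation, so it descends from the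
  probability space to the path space. Passing from all paths to continuous ones changes nothing,
  as every observation is continuous and the \<open>\<sigma>\<close>-algebra is the trace one.
\<close>

lemma law_eq_density:
  "law M (path_space T) U N \<theta>'
     = density (law M (path_space T) U N \<theta>) (\<lambda>x. ennreal (likelihood_ratio N \<theta> \<theta>' x))"
proof -
  let ?Z = "girsanov_density N (drift_change \<theta> \<theta>') T"
  have Z: "?Z \<in> borel_measurable M"
    using girsanov_density_measurable T_pos by simp
  note L = likelihood_ratio_measurable[of N \<theta> \<theta>']
  have "AE \<omega> in M. ?Z \<omega> = likelihood_ratio N \<theta> \<theta>' (U N \<theta> \<omega>)"
    using recovered_noise_U[of N \<theta>]
    by eventually_elim (simp add: girsanov_density_def likelihood_ratio_def)
  then have Z_eq: "density M ?Z = density M (\<lambda>\<omega>. ennreal (likelihood_ratio N \<theta> \<theta>' (U N \<theta> \<omega>)))"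
    using Z measurable_compose[OF U_measurable L]
    by (intro density_cong) auto
  have "distr M (path_space T N) (U N \<theta>') = distr (density M ?Z) (path_space T N) (U N \<theta>)"
  proof (rule measure_eqI)
    fix A assume "A \<in> sets (distr M (path_space T N) (U N \<theta>'))"
    then have A: "A \<in> sets (path_space T N)" by simp
    then obtain B where B: "B \<in> sets (all_paths N)"
      and AB: "A = {x. \<forall>k\<in>{1..N}. continuous_on {0..T} (\<lambda>t. x t k)} \<inter> B"
      unfolding path_space_def sets_restrict_space by auto
    have cont: "U N \<theta>'' \<omega> \<in> {x. \<forall>k\<in>{1..N}. continuous_on {0..T} (\<lambda>t. x t k)}"
      if "\<omega> \<in> space M" for \<theta>'' \<omega>
      using measurable_space[OF U_measurable that, of N \<theta>'']
      by (simp add: path_space_def space_restrict_space)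
    have pre: "U N \<theta>'' -` A \<inter> space M = U N \<theta>'' -` B \<inter> space M" for \<theta>''
      using cont AB by auto
    show "emeasure (distr M (path_space T N) (U N \<theta>')) A
        = emeasure (distr (density M ?Z) (path_space T N) (U N \<theta>)) A"
    proof -
      have dens: "U N \<theta> \<in> measurable (density M ?Z) (all_paths N)"
        "U N \<theta> \<in> measurable (density M ?Z) (path_space T N)"
        using U_measurable U_measurable_all_paths by (simp_all only: measurable_density_eq1)
      have "emeasure M (U N \<theta>' -` B \<inter> space M) = emeasure (density M ?Z) (U N \<theta> -` B \<inter> space M)"
        using arg_cong[OF distr_all_paths_girsanov[of N \<theta>' \<theta>], of "\<lambda>P. emeasure P B"]
        unfolding emeasure_distr[OF U_measurable_all_paths B] emeasure_distr[OF dens(1) B] space_density .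
      then show ?thesis
        unfolding emeasure_distr[OF U_measurable A] emeasure_distr[OF dens(2) A] space_density pre .
    qed
  qed simp
  also have "\<dots> = density (distr M (path_space T N) (U N \<theta>)) (\<lambda>x. ennreal (likelihood_ratio N \<theta> \<theta>' x))"
    unfolding Z_eq using L U_measurable by (intro density_distr[symmetric]) auto
  finally show ?thesis by (simp add: law_def)
qed

lemma RN_deriv_law:
  "AE \<omega> in M. RN_deriv (law M (path_space T) U N \<theta>) (law M (path_space T) U N \<theta>') (U N \<theta> \<omega>)
     = ennreal (likelihood_ratio N \<theta> \<theta>' (U N \<theta> \<omega>))"
proof -
  interpret P: prob_space "law M (path_space T) U N \<theta>"
    unfolding law_def using U_measurable by (rule prob_space_distr)
  have "AE x in law M (path_space T) U N \<theta>. ennreal (likelihood_ratio N \<theta> \<theta>' x)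
      = RN_deriv (law M (path_space T) U N \<theta>) (law M (path_space T) U N \<theta>') x"
    using likelihood_ratio_measurable
    by (intro P.RN_deriv_unique law_eq_density[symmetric]) (simp add: law_def)
  from AE_distrD[OF U_measurable this[unfolded law_def]] show ?thesis
    unfolding law_def by eventually_elim simp
qed

section \<open>Local expansion of the likelihood ratio\<close>

text \<open>
  Up to the factor \<open>\<sigma>\<^sup>2\<close> this is the Fisher information of the first \<open>N\<close> modes: with a drift
  proportional to \<open>\<mu> k / q k\<close>, the quadratic term in the log-likelihood is proportional to it.
\<close>

definition precision :: "nat \<Rightarrow> real" where
  "precision N = T * (\<Sum>k=1..N. (\<mu> k / q k)\<^sup>2)"

lemma precision_pos: "N \<ge> 1 \<Longrightarrow> precision N > 0"
  unfolding precision_def using \<mu>_pos q_pos T_pos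
  by (intro mult_pos_pos sum_pos zero_less_power divide_pos_pos) auto

definition normalized_score :: "nat \<Rightarrow> real \<Rightarrow> (real \<Rightarrow> nat \<Rightarrow> real) \<Rightarrow> real" where
  "normalized_score N \<theta> x = (\<Sum>k=1..N. - (\<mu> k / q k / sqrt (precision N)) * recovered_noise \<theta> k x)"

lemma normalized_score_measurable: "normalized_score N \<theta> \<in> borel_measurable (path_space T N)"
  unfolding normalized_score_def[abs_def] using recovered_noise_measurable
  by (intro borel_measurable_sum borel_measurable_times borel_measurable_const) auto

text \<open>
  The local shift \<open>\<sigma> / sqrt (precision N) * h\<close> of the parameter gives the drifts
  \<open>- h * \<mu> k / (q k * sqrt (precision N))\<close>, whose squares sum to \<open>h\<^sup>2 / T\<close>. The
  log-likelihood is therefore quadratic in \<open>h\<close> without any remainder.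
\<close>

lemma likelihood_ratio_local:
  assumes "N \<ge> 1"
  shows "likelihood_ratio N \<theta> (\<theta> + \<sigma> / sqrt (precision N) * h) x = exp (h * normalized_score N \<theta> x - h\<^sup>2 / 2)"
proof -
  let ?s = "sqrt (precision N)" and ?c = "drift_change \<theta> (\<theta> + \<sigma> / sqrt (precision N) * h)"
  have s: "?s > 0" "?s\<^sup>2 = precision N" using precision_pos[OF assms] by auto
  have c: "?c k = h * - (\<mu> k / q k / ?s)" if "k \<in> {1..N}" for k
    using \<sigma>_pos by (simp add: drift_change_def)
  have "(\<Sum>k=1..N. ?c k * recovered_noise \<theta> k x) = h * normalized_score N \<theta> x"
    unfolding normalized_score_def sum_distrib_left by (intro sum.cong refl) (simp only: c mult.assoc)
  moreover have "(\<Sum>k=1..N. (?c k)\<^sup>2 * T / 2) = h\<^sup>2 / 2"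
  proof -
    have "(\<Sum>k=1..N. (?c k)\<^sup>2 * T / 2) = (\<Sum>k=1..N. h\<^sup>2 / (2 * precision N) * (T * (\<mu> k / q k)\<^sup>2))"
    proof (rule sum.cong[OF refl])
      fix k assume k: "k \<in> {1..N}"
      show "(?c k)\<^sup>2 * T / 2 = h\<^sup>2 / (2 * precision N) * (T * (\<mu> k / q k)\<^sup>2)"
        unfolding c[OF k] by (simp add: power_mult_distrib power_divide s(2) mult_ac)
    qed
    also have "\<dots> = h\<^sup>2 / (2 * precision N) * precision N"
      unfolding precision_def by (simp only: sum_distrib_left)
    finally show ?thesis using precision_pos[OF assms] by simp
  qed
  ultimately show ?thesis
    unfolding likelihood_ratio_def by (simp add: sum_subtractf)
qed

text \<open>
  Almost surely the score is a linear combination of the independent normal increments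
  \<open>w k T - w k 0\<close>, and \<open>precision N\<close> normalises its variance to one. The law is exactly standard
  normal for each \<open>N\<close>, so the convergence in distribution is trivial.
\<close>

lemma distr_normalized_score:
  assumes "N \<ge> 1"
  shows "distr M borel (\<lambda>\<omega>. normalized_score N \<theta> (U N \<theta> \<omega>)) = std_normal_distribution"
proof -
  define a where "a k = - (\<mu> k / q k / sqrt (precision N))" for k
  let ?S = "\<lambda>\<omega>. \<Sum>k=1..N. a k * (w k T \<omega> - w k 0 \<omega>)"
  have a: "a k \<noteq> 0" if "k \<in> {1..N}" for k
    using \<mu>_pos[of k] q_pos[of k] precision_pos[OF assms] that by (simp add: a_def)
  have "indep_vars (\<lambda>_. borel) (\<lambda>k \<omega>. if k = 0 then 0 else a k * (w k T \<omega> - w k 0 \<omega>)) {1..N}"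
    by (rule indep_vars_subset[OF indep_vars_past_and_increments[where g = "\<lambda>k x. a k * x"]])
       (use T_pos in auto)
  then have indep: "indep_vars (\<lambda>_. borel) (\<lambda>k \<omega>. a k * (w k T \<omega> - w k 0 \<omega>)) {1..N}"
    by (rule indep_vars_cong[THEN iffD1, rotated -1]) auto
  have "distributed M lborel (\<lambda>\<omega>. a k * (w k T \<omega> - w k 0 \<omega>)) (normal_density 0 (\<bar>a k\<bar> * sqrt T))"
    if "k \<in> {1..N}" for k
    using normal_density_affine[OF increment_normal[of k 0 T], of "a k" 0] a[OF that] that T_pos by simp
  then have "distributed M lborel ?S
      (normal_density (\<Sum>k\<in>{1..N}. 0) (sqrt (\<Sum>k\<in>{1..N}. (\<bar>a k\<bar> * sqrt T)\<^sup>2)))"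
    using assms a T_pos by (intro sum_indep_normal indep) auto
  moreover have "(\<Sum>k\<in>{1..N}. (\<bar>a k\<bar> * sqrt T)\<^sup>2) = 1"
  proof -
    have "(\<Sum>k\<in>{1..N}. (\<bar>a k\<bar> * sqrt T)\<^sup>2) = (\<Sum>k\<in>{1..N}. 1 / precision N * (T * (\<mu> k / q k)\<^sup>2))"
      using precision_pos[OF assms] T_pos
      by (intro sum.cong refl) (simp add: a_def power_mult_distrib power_divide mult_ac)
    also have "\<dots> = 1 / precision N * precision N"
      unfolding precision_def by (simp only: sum_distrib_left)
    finally show ?thesis using precision_pos[OF assms] by simp
  qed
  ultimately have S: "distributed M lborel ?S std_normal_density" by simp
  have "AE \<omega> in M. normalized_score N \<theta> (U N \<theta> \<omega>) = ?S \<omega>"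
    using recovered_noise_U[of N \<theta>] by eventually_elim (simp add: normalized_score_def a_def)
  then have "distr M borel (\<lambda>\<omega>. normalized_score N \<theta> (U N \<theta> \<omega>)) = distr M borel ?S"
    using measurable_compose[OF U_measurable normalized_score_measurable] distributed_measurable[OF S]
    by (intro distr_cong_AE) auto
  also have "\<dots> = distr M lborel ?S" by (rule distr_cong) auto
  also have "\<dots> = std_normal_distribution" using S by (rule distributed_distr_eq_density)
  finally show ?thesis .
qed

lemma uniformly_asymptotically_normal_U:
  "uniformly_asymptotically_normal M (path_space T) U"
  unfolding uniformly_asymptotically_normal_def
proof (intro exI[of _ "\<lambda>N (\<theta>::real). \<sigma> / sqrt (precision N)"] exI[of _ normalized_score] conjI allI impI)
  fix \<theta>0 h :: "nat \<Rightarrow> real" and \<eta> :: real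
  assume h: "h \<longlonglongrightarrow> \<eta>"
  define D where "D N \<omega> = normalized_score N (\<theta>0 N) (U N (\<theta>0 N) \<omega>)" for N \<omega>
  \<comment> \<open>The log-likelihood is exact at \<open>h N\<close>; the remainder comes from writing \<open>\<eta>\<close> for \<open>h N\<close>.\<close>
  define \<Psi> where "\<Psi> N \<omega> = (h N - \<eta>) * D N \<omega> + (\<eta>\<^sup>2 - (h N)\<^sup>2) / 2" for N \<omega>
  have D: "D N \<in> borel_measurable M" for N
    unfolding D_def[abs_def] by (rule measurable_compose[OF U_measurable normalized_score_measurable])
  have distr_D: "distr M borel (D N) = std_normal_distribution" if "N \<ge> 1" for N
    unfolding D_def[abs_def] using distr_normalized_score[OF that] .
  have "tendsto_zero_in_prob M \<Psi>"
    unfolding \<Psi>_def[abs_def]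
  proof (rule tendsto_zero_in_prob_affine[OF distr_D D])
    show "integrable std_normal_distribution (\<lambda>x. x)"
      using integrable_std_normal_moment[of 1] by (simp add: integrable_density)
    show "(\<lambda>N. h N - \<eta>) \<longlonglongrightarrow> 0" using h by (simp add: LIM_zero)
    have "(\<lambda>N. (\<eta>\<^sup>2 - (h N)\<^sup>2) / 2) \<longlonglongrightarrow> (\<eta>\<^sup>2 - \<eta>\<^sup>2) / 2" by (intro tendsto_intros h) auto
    then show "(\<lambda>N. (\<eta>\<^sup>2 - (h N)\<^sup>2) / 2) \<longlonglongrightarrow> 0" by simp
  qed auto
  moreover have "AE \<omega> in M. RN_deriv (law M (path_space T) U N (\<theta>0 N))
        (law M (path_space T) U N (\<theta>0 N + \<sigma> / sqrt (precision N) * h N)) (U N (\<theta>0 N) \<omega>)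
      = ennreal (exp (\<eta> * normalized_score N (\<theta>0 N) (U N (\<theta>0 N) \<omega>) - \<eta>\<^sup>2 / 2 + \<Psi> N \<omega>))"
    if "N \<ge> 1" for N
    using RN_deriv_law[of N "\<theta>0 N" "\<theta>0 N + \<sigma> / sqrt (precision N) * h N"]
  proof eventually_elim
    case (elim \<omega>)
    have "h N * D N \<omega> - (h N)\<^sup>2 / 2 = \<eta> * D N \<omega> - \<eta>\<^sup>2 / 2 + \<Psi> N \<omega>"
      by (simp add: \<Psi>_def algebra_simps diff_divide_distrib)
    then show ?case
      unfolding elim likelihood_ratio_local[OF that] by (simp add: D_def)
  qed
  moreover have "\<Psi> N \<in> borel_measurable M" for N
    unfolding \<Psi>_def[abs_def] using D[of N] by simp
  ultimately show "\<exists>\<Psi>. (\<forall>N\<ge>1. \<Psi> N \<in> borel_measurable M) \<and>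
      (\<forall>N\<ge>1. AE \<omega> in M. RN_deriv (law M (path_space T) U N (\<theta>0 N))
        (law M (path_space T) U N (\<theta>0 N + \<sigma> / sqrt (precision N) * h N)) (U N (\<theta>0 N) \<omega>)
      = ennreal (exp (\<eta> * normalized_score N (\<theta>0 N) (U N (\<theta>0 N) \<omega>) - \<eta>\<^sup>2 / 2 + \<Psi> N \<omega>))) \<and>
      tendsto_zero_in_prob M \<Psi>"
    by blast
  show "weak_conv_m (\<lambda>N. distr M borel (\<lambda>\<omega>. normalized_score N (\<theta>0 N) (U N (\<theta>0 N) \<omega>)))
      std_normal_distribution"
    unfolding weak_conv_m_def weak_conv_def
    by (auto intro!: tendsto_eventually eventually_sequentiallyI[of 1] simp: distr_normalized_score)
qed (use \<sigma>_pos precision_pos normalized_score_measurable in \<open>force+\<close>)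

end

theorem theorem2p4:
  fixes M :: "'a measure" and F :: "real \<Rightarrow> 'a measure"
    and w :: "nat \<Rightarrow> real \<Rightarrow> 'a \<Rightarrow> real" and u0 :: "nat \<Rightarrow> 'a \<Rightarrow> real"
    and \<mu> q :: "nat \<Rightarrow> real" and \<sigma> T :: real
  assumes "stochastic_basis M F"
    and "stochastic_basis.independent_brownian_motions M F w"
    and "\<And>k. k \<ge> 1 \<Longrightarrow> \<mu> k > 0" and "filterlim \<mu> at_top sequentially"
    and "\<And>k. k \<ge> 1 \<Longrightarrow> q k > 0"
    and "\<sigma> > 0" and "T > 0"
    and "\<And>k. k \<ge> 1 \<Longrightarrow> u0 k \<in> borel_measurable (F 0)"
    and "\<And>k. k \<ge> 1 \<Longrightarrow> AE \<omega> in M. u0 k \<omega> \<noteq> 0"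
  shows "uniformly_asymptotically_normal M (path_space T) (observed_path \<mu> q \<sigma> u0 w T)"
proof -
  interpret stochastic_basis M F by fact
  interpret diagonal_diffusion M F w u0 \<mu> q \<sigma> T
    by unfold_locales (fact assms)+
  show ?thesis by (rule uniformly_asymptotically_normal_U)
qed

end
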